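(* Let $R$ be a Noetherian ring of positive prime characteristic $p$ and let $I$ be an ideal of $R$ generated by a regular sequence. Then for all $n\ge 1$, $$I^n\cap (I^{n+1})^*=I^n I^*.$$
   Context: $J^*$ denotes the tight closure of an ideal $J$: with $R^\circ$ the set of elements of $R$ not in any minimal prime and $J^{[q]}$ the ideal generated by the $q$-th powers of elements of $J$ ($q=p^e$), $x\in J^*$ if and only if there is $c\in R^\circ$ such that $cx^q\in J^{[q]}$ for all sufficiently large $q=p^e$. *)

theory Defs
  imports "HOL-Algebra.Algebra" "HOL-Computational_Algebra.Primes"
begin

text \<open>The additive order of \<open>\<one>\<close>; the library's \<open>ord\<close> is \<open>0\<close> when no positive multiple vanishes.\<close>

definition ring_char :: "('a, 'b) ring_scheme \<Rightarrow> nat" where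
  "ring_char R = group.ord (add_monoid R) \<one>\<^bsub>R\<^esub>"

text \<open>\<open>ideals_set R\<close> is the library's semiring of ideals, with multiplication \<open>ideal_prod R\<close> and
  unit \<open>carrier R\<close>.\<close>

abbreviation ideal_pow :: "('a, 'b) ring_scheme \<Rightarrow> 'a set \<Rightarrow> nat \<Rightarrow> 'a set" where
  "ideal_pow R I n \<equiv> I [^]\<^bsub>ideals_set R\<^esub> n"

definition nonzerodivisor :: "('a, 'b) ring_scheme \<Rightarrow> 'a \<Rightarrow> bool" where
  "nonzerodivisor R x \<longleftrightarrow>
     x \<in> carrier R \<and> (\<forall>y\<in>carrier R. x \<otimes>\<^bsub>R\<^esub> y = \<zero>\<^bsub>R\<^esub> \<longrightarrow> y = \<zero>\<^bsub>R\<^esub>)"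

text \<open>The zero ring has only nonzerodivisors in the above sense; the last conjunct below is the usual
  requirement that the sequence generate a proper ideal.\<close>

definition regular_sequence :: "('a, 'b) ring_scheme \<Rightarrow> 'a list \<Rightarrow> bool" where
  "regular_sequence R xs \<longleftrightarrow>
     set xs \<subseteq> carrier R \<and>
     (\<forall>i<length xs. let J = Idl\<^bsub>R\<^esub> (set (take i xs)) in
        nonzerodivisor (R Quot J) (J +>\<^bsub>R\<^esub> (xs ! i))) \<and>
     Idl\<^bsub>R\<^esub> (set xs) \<noteq> carrier R"

definition minimal_prime :: "('a, 'b) ring_scheme \<Rightarrow> 'a set \<Rightarrow> bool" where
  "minimal_prime R P \<longleftrightarrow> primeideal P R \<and> (\<forall>Q. primeideal Q R \<and> Q \<subseteq> P \<longrightarrow> Q = P)"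

text \<open>The set \<open>R\<degree>\<close>.\<close>

definition ring_circ :: "('a, 'b) ring_scheme \<Rightarrow> 'a set" where
  "ring_circ R = {c \<in> carrier R. \<forall>P. minimal_prime R P \<longrightarrow> c \<notin> P}"

definition frobenius_power :: "('a, 'b) ring_scheme \<Rightarrow> 'a set \<Rightarrow> nat \<Rightarrow> 'a set" where
  "frobenius_power R J q = Idl\<^bsub>R\<^esub> ((\<lambda>x. x [^]\<^bsub>R\<^esub> q) ` J)"

text \<open>The parameter \<open>p\<close> is meant to be the characteristic of \<open>R\<close>.\<close>

definition tight_closure :: "('a, 'b) ring_scheme \<Rightarrow> nat \<Rightarrow> 'a set \<Rightarrow> 'a set" where
  "tight_closure R p J =
     {x \<in> carrier R. \<exists>c\<in>ring_circ R. \<exists>e\<^sub>0. \<forall>e\<ge>e\<^sub>0.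
        c \<otimes>\<^bsub>R\<^esub> x [^]\<^bsub>R\<^esub> (p ^ e) \<in> frobenius_power R J (p ^ e)}"

end

theory Submission
  imports Defs
begin

text \<open>
  Write \<open>u \<in> I\<^sup>n\<close> as a form of degree \<open>n\<close> in \<open>x\<^sub>1, \<dots>, x\<^sub>k\<close> with coefficients \<open>r\<^sub>\<alpha>\<close>. By additivity of
  Frobenius, \<open>c u\<^sup>q\<close> is the form in \<open>x\<^sub>1\<^sup>q, \<dots>, x\<^sub>k\<^sup>q\<close> with coefficients \<open>c r\<^sub>\<alpha>\<^sup>q\<close>,
  and if \<open>u\<close> is in the tight closure of \<open>I\<^sup>n\<^sup>+\<^sup>1\<close> it lies in the \<open>(n+1)\<close>-st power of the ideal generated by these powers. Powers of a regular
  sequence again form a regular sequence, and a regular sequence is quasi-regular: a form of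
  degree \<open>n\<close> whose value lies in the \<open>(n+1)\<close>-st power of the ideal has all coefficients in the
  ideal. Hence \<open>c r\<^sub>\<alpha>\<^sup>q \<in> I\<^sup>[\<^sup>q\<^sup>]\<close> for all large \<open>q\<close>, that is, \<open>r\<^sub>\<alpha> \<in> I\<^sup>*\<close>.
\<close>

section \<open>Forms and regular sequences\<close>

text \<open>
  A form of degree \<open>Suc n\<close> in \<open>x # xs\<close> is uniquely \<open>G + x H\<close> with \<open>G\<close> a form in \<open>xs\<close> and \<open>H\<close> of degree
  \<open>n\<close>; a monomial is encoded by the path of choices \<open>G\<close> (\<open>False\<close>) or \<open>H\<close> (\<open>True\<close>) leading to its
  coefficient. Coefficients at other paths are irrelevant.
\<close>

fun form_eval :: "('a, 'b) ring_scheme \<Rightarrow> 'a list \<Rightarrow> nat \<Rightarrow> (bool list \<Rightarrow> 'a) \<Rightarrow> 'a" where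
  "form_eval R xs 0 a = a []"
| "form_eval R [] (Suc n) a = \<zero>\<^bsub>R\<^esub>"
| "form_eval R (x # xs) (Suc n) a =
     form_eval R xs (Suc n) (\<lambda>\<alpha>. a (False # \<alpha>)) \<oplus>\<^bsub>R\<^esub>
     x \<otimes>\<^bsub>R\<^esub> form_eval R (x # xs) n (\<lambda>\<alpha>. a (True # \<alpha>))"

fun monomials :: "'a list \<Rightarrow> nat \<Rightarrow> bool list set" where
  "monomials xs 0 = {[]}"
| "monomials [] (Suc n) = {}"
| "monomials (x # xs) (Suc n) =
     (#) False ` monomials xs (Suc n) \<union> (#) True ` monomials (x # xs) n"

text \<open>The set of values of degree-\<open>n\<close> forms with coefficients in
  \<open>L\<close>; it turns out to be the product of \<open>L\<close> with the \<open>n\<close>-th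
  power of the ideal generated by \<open>xs\<close>. Every path, even an irrelevant one, must carry
  a value in \<open>L\<close>, so witnesses need a suitable default there.\<close>

definition forms :: "('a, 'b) ring_scheme \<Rightarrow> 'a set \<Rightarrow> 'a list \<Rightarrow> nat \<Rightarrow> 'a set" where
  "forms R L xs n = {form_eval R xs n a | a. \<forall>\<alpha>. a \<alpha> \<in> L}"

text \<open>The usual notion of a weakly regular sequence on the module R/(S), phrased by ideal
  membership instead of quotient rings. The set \<open>S\<close> collects the elements already
  passed, so inductions can vary the base.\<close>

primrec weakly_regular :: "('a, 'b) ring_scheme \<Rightarrow> 'a set \<Rightarrow> 'a list \<Rightarrow> bool" where
  "weakly_regular R S [] \<longleftrightarrow> True"
| "weakly_regular R S (x # xs) \<longleftrightarrow>
     (\<forall>r\<in>carrier R. x \<otimes>\<^bsub>R\<^esub> r \<in> Idl\<^bsub>R\<^esub> S \<longrightarrow> r \<in> Idl\<^bsub>R\<^esub> S) \<and> weakly_regular R (insert x S) xs"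

text \<open>In other words, the monomials of degree \<open>n\<close> are independent over R/I in
  I^n/I^(n+1): the associated graded ring of I is a polynomial ring over R/I.\<close>

definition quasi_regular :: "('a, 'b) ring_scheme \<Rightarrow> 'a list \<Rightarrow> bool" where
  "quasi_regular R xs \<longleftrightarrow>
     (\<forall>n a. (\<forall>\<alpha>. a \<alpha> \<in> carrier R) \<longrightarrow>
        form_eval R xs n a \<in> ideal_pow R (Idl\<^bsub>R\<^esub> (set xs)) (Suc n) \<longrightarrow>
        (\<forall>\<alpha>\<in>monomials xs n. a \<alpha> \<in> Idl\<^bsub>R\<^esub> (set xs)))"

lemma quasi_regularD:
  assumes "quasi_regular R xs" "\<forall>\<alpha>. a \<alpha> \<in> carrier R"
    and "form_eval R xs n a \<in> ideal_pow R (Idl\<^bsub>R\<^esub> (set xs)) (Suc n)"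
  shows "\<forall>\<alpha>\<in>monomials xs n. a \<alpha> \<in> Idl\<^bsub>R\<^esub> (set xs)"
  using assms unfolding quasi_regular_def by blast

text \<open>Links the recursive notion to the indexed prefixes in
  \<open>regular_sequence\<close>.\<close>

lemma weakly_regular_iff_nth:
  "weakly_regular R S xs \<longleftrightarrow>
     (\<forall>i<length xs. \<forall>r\<in>carrier R.
        xs ! i \<otimes>\<^bsub>R\<^esub> r \<in> Idl\<^bsub>R\<^esub> (S \<union> set (take i xs)) \<longrightarrow> r \<in> Idl\<^bsub>R\<^esub> (S \<union> set (take i xs)))"
  by (induction xs arbitrary: S) (simp_all add: All_less_Suc2)

text \<open>Splitting off the last element is what the induction for quasi-regularity needs, where
  the list is reversed.\<close>

lemma weakly_regular_snoc:
  "weakly_regular R S (xs @ [x]) \<longleftrightarrow>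
     weakly_regular R S xs \<and>
     (\<forall>r\<in>carrier R. x \<otimes>\<^bsub>R\<^esub> r \<in> Idl\<^bsub>R\<^esub> (S \<union> set xs) \<longrightarrow> r \<in> Idl\<^bsub>R\<^esub> (S \<union> set xs))"
  by (induction xs arbitrary: S) auto

section \<open>Products and powers of ideals\<close>

lemma ideal_prod_mono:
  assumes "I \<subseteq> I'" "J \<subseteq> J'"
  shows "ideal_prod R I J \<subseteq> ideal_prod R I' J'"
proof
  fix u assume "u \<in> ideal_prod R I J"
  then show "u \<in> ideal_prod R I' J'"
    by induction (use assms in \<open>auto intro: ideal_prod.intros\<close>)
qed

lemma one_ideals_set [simp]: "\<one>\<^bsub>ideals_set R\<^esub> = carrier R"
  by (simp add: ideals_set_def)

lemma mult_ideals_set [simp]: "I \<otimes>\<^bsub>ideals_set R\<^esub> J = ideal_prod R I J"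
  by (simp add: ideals_set_def)

lemma ideal_pow_Suc: "ideal_pow R I (Suc n) = ideal_prod R (ideal_pow R I n) I"
  by simp

lemma ideal_pow_mono:
  assumes "I \<subseteq> J"
  shows "ideal_pow R I n \<subseteq> ideal_pow R J n"
  by (induction n) (simp_all add: ideal_prod_mono assms)

context cring
begin

lemma is_idealI:
  assumes "J \<subseteq> carrier R" "\<zero> \<in> J"
    and "\<And>x y. x \<in> J \<Longrightarrow> y \<in> J \<Longrightarrow> x \<oplus> y \<in> J"
    and smult: "\<And>r x. r \<in> carrier R \<Longrightarrow> x \<in> J \<Longrightarrow> r \<otimes> x \<in> J"
  shows "ideal J R"
proof (rule idealI)
  have "\<ominus> x \<in> J" if "x \<in> J" for x
    using smult[of "\<ominus> \<one>" x] that assms(1) by (auto simp: l_minus)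
  then show "subgroup J (add_monoid R)"
    using assms by (intro add.subgroupI) (auto simp flip: a_inv_def)
  show "r \<otimes> x \<in> J" "x \<otimes> r \<in> J" if "x \<in> J" "r \<in> carrier R" for x r
    using assms(1) smult[OF that(2,1)] m_comm[of x r] that by auto
qed (rule ring_axioms)

lemma ideal_pow_is_ideal: "ideal I R \<Longrightarrow> ideal (ideal_pow R I n) R"
  by (induction n) (auto intro: ideal_prod_is_ideal oneideal)

lemma ideal_prod_carrier_left: "ideal I R \<Longrightarrow> ideal_prod R (carrier R) I = I"
  using ideal_prod_commute[OF oneideal] ideal_prod_one by metis

lemma ideal_prod_subset:
  assumes "ideal K R" "\<And>i j. i \<in> I \<Longrightarrow> j \<in> J \<Longrightarrow> i \<otimes> j \<in> K"
  shows "ideal_prod R I J \<subseteq> K"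
proof
  fix u assume "u \<in> ideal_prod R I J"
  then show "u \<in> K"
    by induction (use assms in \<open>auto intro: additive_subgroup.a_closed ideal.axioms\<close>)
qed

lemma ideal_a_closed: "ideal J R \<Longrightarrow> x \<in> J \<Longrightarrow> y \<in> J \<Longrightarrow> x \<oplus> y \<in> J"
  by (simp add: additive_subgroup.a_closed ideal.axioms(1))

lemma ideal_minus_closed: "ideal J R \<Longrightarrow> x \<in> J \<Longrightarrow> y \<in> J \<Longrightarrow> x \<ominus> y \<in> J"
  by (simp add: a_minus_def additive_subgroup.a_closed additive_subgroup.a_inv_closed ideal.axioms(1))

lemma ideal_zero_closed: "ideal J R \<Longrightarrow> \<zero> \<in> J"
  by (simp add: additive_subgroup.zero_closed ideal.axioms(1))

lemma ideal_add_left_cancel: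
  assumes "ideal J R" "x \<in> J" "y \<in> carrier R" "x \<oplus> y \<in> J"
  shows "y \<in> J"
proof -
  have x: "x \<in> carrier R"
    using assms by (meson ideal.Icarr)
  have "y = (x \<oplus> y) \<ominus> x"
    using x assms(3) by (simp add: a_minus_def a_assoc a_comm[of x] r_neg)
  then show ?thesis
    using ideal_minus_closed[OF assms(1,4,2)] by simp
qed

section \<open>Forms and powers of ideals\<close>

lemma form_eval_closed:
  assumes "set xs \<subseteq> carrier R" "\<forall>\<alpha>. a \<alpha> \<in> carrier R"
  shows "form_eval R xs n a \<in> carrier R"
  using assms by (induction xs n arbitrary: a rule: monomials.induct) auto

lemma form_eval_add:
  assumes "set xs \<subseteq> carrier R" "\<forall>\<alpha>. a \<alpha> \<in> carrier R" "\<forall>\<alpha>. b \<alpha> \<in> carrier R"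
  shows "form_eval R xs n (\<lambda>\<alpha>. a \<alpha> \<oplus> b \<alpha>) = form_eval R xs n a \<oplus> form_eval R xs n b"
  using assms
proof (induction xs n arbitrary: a b rule: monomials.induct)
  case (3 x xs n)
  then show ?case
    by (simp add: form_eval_closed r_distr a_ac)
qed auto

lemma form_eval_smult:
  assumes "set xs \<subseteq> carrier R" "\<forall>\<alpha>. a \<alpha> \<in> carrier R" "c \<in> carrier R"
  shows "form_eval R xs n (\<lambda>\<alpha>. c \<otimes> a \<alpha>) = c \<otimes> form_eval R xs n a"
  using assms
proof (induction xs n arbitrary: a rule: monomials.induct)
  case (3 x xs n)
  then show ?case
    by (simp add: form_eval_closed r_distr m_lcomm)
qed auto

lemma form_eval_zero:
  assumes "set xs \<subseteq> carrier R"
  shows "form_eval R xs n (\<lambda>\<alpha>. \<zero>) = \<zero>"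
  using form_eval_smult[OF assms, of "\<lambda>\<alpha>. \<zero>" \<zero> n] form_eval_closed[OF assms, of "\<lambda>\<alpha>. \<zero>" n]
  by simp

lemma form_eval_minus:
  assumes "set xs \<subseteq> carrier R" "\<forall>\<alpha>. a \<alpha> \<in> carrier R" "\<forall>\<alpha>. b \<alpha> \<in> carrier R"
  shows "form_eval R xs n (\<lambda>\<alpha>. a \<alpha> \<ominus> b \<alpha>) = form_eval R xs n a \<ominus> form_eval R xs n b"
proof -
  have "form_eval R xs n (\<lambda>\<alpha>. \<ominus> \<one> \<otimes> b \<alpha>) = \<ominus> form_eval R xs n b"
    using form_eval_smult[OF assms(1,3), of "\<ominus> \<one>" n] form_eval_closed[OF assms(1,3)]
    by (simp add: l_minus)
  then show ?thesis
    using form_eval_add[OF assms(1,2), of "\<lambda>\<alpha>. \<ominus> \<one> \<otimes> b \<alpha>" n] assms(3)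
    by (simp add: l_minus a_minus_def)
qed

text \<open>By \<open>frob\<close>, raising to the power \<open>q\<close> respects sums as well as
  products, hence commutes with evaluation. Positivity of \<open>q\<close> keeps the empty form at
  zero.\<close>

lemma form_eval_pow:
  assumes "set xs \<subseteq> carrier R" "\<forall>\<alpha>. a \<alpha> \<in> carrier R" "q > 0"
    and frob: "\<And>x y. x \<in> carrier R \<Longrightarrow> y \<in> carrier R \<Longrightarrow>
      (x \<oplus> y) [^] (q::nat) = x [^] q \<oplus> y [^] q"
  shows "form_eval R (map (\<lambda>x. x [^] q) xs) n (\<lambda>\<alpha>. a \<alpha> [^] q) = form_eval R xs n a [^] q"
  using assms(1,2)
proof (induction xs n arbitrary: a rule: monomials.induct)
  case (2 n)
  then show ?case
    using \<open>q > 0\<close> by (simp add: nat_pow_zero)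
next
  case (3 x xs n)
  then show ?case
    by (simp add: form_eval_closed frob nat_pow_distrib)
qed auto

lemma forms_closed:
  assumes "set xs \<subseteq> carrier R" "L \<subseteq> carrier R"
  shows "forms R L xs n \<subseteq> carrier R"
  using assms by (auto simp: forms_def intro!: form_eval_closed)

lemma forms_ideal:
  assumes xs: "set xs \<subseteq> carrier R" and L: "ideal L R"
  shows "ideal (forms R L xs n) R"
proof (rule is_idealI)
  have LR: "L \<subseteq> carrier R"
    using ideal.Icarr[OF L] by blast
  show "forms R L xs n \<subseteq> carrier R"
    using xs LR by (rule forms_closed)
  show "\<zero> \<in> forms R L xs n"
    unfolding forms_def using form_eval_zero[OF xs] ideal_zero_closed[OF L]
    by (intro CollectI exI[of _ "\<lambda>\<alpha>. \<zero>"]) simp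
  show "u \<oplus> v \<in> forms R L xs n" if u: "u \<in> forms R L xs n" and v: "v \<in> forms R L xs n" for u v
  proof -
    obtain a b where a: "u = form_eval R xs n a" "\<forall>\<alpha>. a \<alpha> \<in> L"
      and b: "v = form_eval R xs n b" "\<forall>\<alpha>. b \<alpha> \<in> L"
      using u v unfolding forms_def by auto
    have "u \<oplus> v = form_eval R xs n (\<lambda>\<alpha>. a \<alpha> \<oplus> b \<alpha>)"
      using a b LR form_eval_add[OF xs] by (simp add: subset_iff)
    then show ?thesis
      using a b ideal_a_closed[OF L] unfolding forms_def by auto
  qed
  show "r \<otimes> u \<in> forms R L xs n" if r: "r \<in> carrier R" and u: "u \<in> forms R L xs n" for r u
  proof -
    obtain a where a: "u = form_eval R xs n a" "\<forall>\<alpha>. a \<alpha> \<in> L"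
      using u unfolding forms_def by auto
    have "r \<otimes> u = form_eval R xs n (\<lambda>\<alpha>. r \<otimes> a \<alpha>)"
      using a r LR form_eval_smult[OF xs] by (simp add: subset_iff)
    then show ?thesis
      using a r ideal.I_l_closed[OF L] unfolding forms_def by auto
  qed
qed

lemma forms_0: "forms R L xs 0 = L"
  unfolding forms_def by auto

lemma forms_SucI:
  assumes "g \<in> forms R L xs (Suc n)" "h \<in> forms R L (x # xs) n"
  shows "g \<oplus> x \<otimes> h \<in> forms R L (x # xs) (Suc n)"
proof -
  obtain a b where a: "g = form_eval R xs (Suc n) a" "\<forall>\<alpha>. a \<alpha> \<in> L"
    and b: "h = form_eval R (x # xs) n b" "\<forall>\<alpha>. b \<alpha> \<in> L"
    using assms unfolding forms_def by auto
  \<comment> \<open>Glues the two coefficient families: paths starting with \<open>True\<close> read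
    \<open>b\<close>, all others read \<open>a\<close>. The empty path belongs to no monomial of
    positive degree; it also reads \<open>a\<close> so that its value lies in
    \<open>L\<close>.\<close>
  let ?c = "\<lambda>\<alpha>. if \<alpha> \<noteq> [] \<and> hd \<alpha> then b (tl \<alpha>) else a (tl \<alpha>)"
  have "g \<oplus> x \<otimes> h = form_eval R (x # xs) (Suc n) ?c"
    using a b by simp
  moreover have "\<forall>\<alpha>. ?c \<alpha> \<in> L"
    using a b by auto
  ultimately show ?thesis
    unfolding forms_def by blast
qed

lemma forms_SucE:
  assumes "u \<in> forms R L (x # xs) (Suc n)"
  obtains g h where "g \<in> forms R L xs (Suc n)" "h \<in> forms R L (x # xs) n" "u = g \<oplus> x \<otimes> h"
proof -
  obtain a where a: "u = form_eval R (x # xs) (Suc n) a" "\<forall>\<alpha>. a \<alpha> \<in> L"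
    using assms unfolding forms_def by auto
  show thesis
  proof (rule that)
    show "form_eval R xs (Suc n) (\<lambda>\<alpha>. a (False # \<alpha>)) \<in> forms R L xs (Suc n)"
      "form_eval R (x # xs) n (\<lambda>\<alpha>. a (True # \<alpha>)) \<in> forms R L (x # xs) n"
      using a unfolding forms_def by blast+
  qed (use a in simp)
qed

text \<open>If \<open>y\<close> is the head variable, \<open>u\<close> itself becomes the part
  multiplied by it, with zero as the other part. Otherwise \<open>y\<close> is distributed over both
  parts of \<open>u\<close> and the recursion continues.\<close>

lemma forms_mult_gen:
  assumes "ideal L R" "set xs \<subseteq> carrier R" "y \<in> set xs" "u \<in> forms R L xs n"
  shows "y \<otimes> u \<in> forms R L xs (Suc n)"
  using assms(2-)
proof (induction xs n arbitrary: u rule: monomials.induct)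
  case (1 xs)
  \<comment> \<open>In degree 0 the form is a single coefficient, so a separate induction on the
    list has to find the position of \<open>y\<close>.\<close>
  then show ?case
  proof (induction xs)
    case (Cons x xs)
    have zero: "\<zero> \<in> forms R L xs' m" if "set xs' \<subseteq> carrier R" for xs' m
      using that forms_ideal[OF _ assms(1)] ideal_zero_closed by blast
    have u: "u \<in> L" "u \<in> carrier R"
      using Cons.prems ideal.Icarr[OF assms(1)] by (auto simp: forms_0)
    show ?case
    proof (cases "y = x")
      case True
      then show ?thesis
        using forms_SucI[of \<zero> L xs 0 u x] zero u Cons.prems by (simp add: forms_0)
    next
      case False
      then have "y \<otimes> u \<in> forms R L xs (Suc 0)"
        using Cons by (simp add: forms_0)
      then have "y \<otimes> u \<oplus> x \<otimes> \<zero> \<in> forms R L (x # xs) (Suc 0)"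
        using zero[of "x # xs" 0] Cons.prems(1) by (intro forms_SucI) auto
      moreover have "y \<in> carrier R"
        using False Cons.prems by auto
      ultimately show ?thesis
        using u Cons.prems by simp
    qed
  qed simp
next
  case (3 x xs n)
  have LR: "L \<subseteq> carrier R"
    using ideal.Icarr[OF assms(1)] by blast
  have c: "x \<in> carrier R" "set xs \<subseteq> carrier R" "y \<in> carrier R"
    using "3.prems" by auto
  have uc: "u \<in> carrier R"
    using "3.prems" forms_closed[OF _ LR] by blast
  show ?case
  proof (cases "y = x")
    case True
    have "\<zero> \<in> forms R L xs (Suc (Suc n))"
      using c forms_ideal[OF _ assms(1)] ideal_zero_closed by blast
    then show ?thesis
      using forms_SucI[of \<zero> L xs "Suc n" u x] "3.prems" True uc c by simp
  next
    case False
    obtain g h where gh: "g \<in> forms R L xs (Suc n)" "h \<in> forms R L (x # xs) n" "u = g \<oplus> x \<otimes> h"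
      using "3.prems"(3) by (rule forms_SucE)
    have "g \<in> carrier R" "h \<in> carrier R"
      using gh forms_closed[OF _ LR] "3.prems" c by blast+
    then have "y \<otimes> u = y \<otimes> g \<oplus> x \<otimes> (y \<otimes> h)"
      using gh c by (simp add: r_distr m_lcomm)
    moreover have "y \<otimes> g \<in> forms R L xs (Suc (Suc n))"
      using "3.IH"(1) gh False "3.prems" by simp
    moreover have "y \<otimes> h \<in> forms R L (x # xs) (Suc n)"
      using "3.IH"(2) gh "3.prems" by simp
    ultimately show ?thesis
      using forms_SucI by simp
  qed
qed simp

lemma forms_mult_Idl:
  assumes L: "ideal L R" and xs: "set xs \<subseteq> carrier R"
  shows "ideal_prod R (forms R L xs n) (Idl (set xs)) \<subseteq> forms R L xs (Suc n)"
proof (rule ideal_prod_subset)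
  let ?F = "forms R L xs n" and ?G = "forms R L xs (Suc n)"
  have Fc: "u \<in> carrier R" if "u \<in> ?F" for u
    using that ideal.Icarr[OF forms_ideal[OF xs L]] by blast
  show G: "ideal ?G R"
    using xs L by (rule forms_ideal)
  \<comment> \<open>The elements that multiply all forms of degree \<open>n\<close> into forms of
    degree \<open>Suc n\<close> make up an ideal, so it suffices that it contains the
    generators.\<close>
  let ?K = "{y \<in> carrier R. \<forall>u\<in>?F. y \<otimes> u \<in> ?G}"
  have "ideal ?K R"
  proof (rule is_idealI)
    show "\<zero> \<in> ?K"
      using Fc ideal_zero_closed[OF G] by simp
    show "y \<oplus> z \<in> ?K" if "y \<in> ?K" "z \<in> ?K" for y z
      using that Fc by (simp add: l_distr ideal_a_closed[OF G])
    show "r \<otimes> y \<in> ?K" if "r \<in> carrier R" "y \<in> ?K" for r y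
      using that Fc by (simp add: m_assoc ideal.I_l_closed[OF G])
  qed blast
  moreover have "set xs \<subseteq> ?K"
    using forms_mult_gen[OF L xs] xs by blast
  ultimately have K: "Idl (set xs) \<subseteq> ?K"
    by (rule genideal_minimal)
  show "i \<otimes> j \<in> ?G" if "i \<in> ?F" "j \<in> Idl (set xs)" for i j
  proof -
    have "j \<in> carrier R" "j \<otimes> i \<in> ?G"
      using K that by blast+
    then show ?thesis
      using m_comm[OF Fc[OF that(1)]] by simp
  qed
qed

lemma Idl_mono: "T \<subseteq> carrier R \<Longrightarrow> S \<subseteq> T \<Longrightarrow> Idl S \<subseteq> Idl T"
  by (metis subset_Idl_subset genideal_self subset_trans)

text \<open>Constrains only coefficients at genuine monomials, because quasi-regularity yields no
  information about other paths. Each passage through the head variable contributes one more factor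
  from the ideal.\<close>

lemma form_eval_mem:
  assumes L: "ideal L R" and "set xs \<subseteq> carrier R" "\<forall>\<alpha>\<in>monomials xs n. a \<alpha> \<in> L"
  shows "form_eval R xs n a \<in> ideal_prod R L (ideal_pow R (Idl (set xs)) n)"
  using assms(2-)
proof (induction xs n arbitrary: a rule: monomials.induct)
  case (1 xs)
  then show ?case
    by (simp add: ideal_prod_one[OF L])
next
  case (2 n)
  then show ?case
    by (simp del: nat_pow_Suc add: ideal_zero_closed ideal_prod_is_ideal ideal_pow_is_ideal genideal_ideal L)
next
  case (3 x xs n)
  let ?I = "Idl (set (x # xs))"
  have I: "ideal ?I R"
    using "3.prems" by (intro genideal_ideal) simp
  have P: "ideal (ideal_pow R ?I m) R" for m
    using I by (rule ideal_pow_is_ideal)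
  have LP: "ideal (ideal_prod R L (ideal_pow R ?I m)) R" for m
    using L P by (rule ideal_prod_is_ideal)
  have "form_eval R xs (Suc n) (\<lambda>\<alpha>. a (False # \<alpha>)) \<in> ideal_prod R L (ideal_pow R (Idl (set xs)) (Suc n))"
    using 3 by (simp del: nat_pow_Suc)
  moreover have "Idl (set xs) \<subseteq> ?I"
    using "3.prems" by (intro Idl_mono) auto
  ultimately have g: "form_eval R xs (Suc n) (\<lambda>\<alpha>. a (False # \<alpha>)) \<in> ideal_prod R L (ideal_pow R ?I (Suc n))"
    using ideal_prod_mono[OF order_refl ideal_pow_mono] by blast
  let ?h = "form_eval R (x # xs) n (\<lambda>\<alpha>. a (True # \<alpha>))"
  have h: "?h \<in> ideal_prod R L (ideal_pow R ?I n)"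
    using 3 by simp
  have "x \<in> ?I"
    using genideal_self[of "set (x # xs)"] "3.prems" by auto
  with h have "?h \<otimes> x \<in> ideal_prod R (ideal_prod R L (ideal_pow R ?I n)) ?I"
    by (rule ideal_prod.prod)
  then have "?h \<otimes> x \<in> ideal_prod R L (ideal_pow R ?I (Suc n))"
    by (simp only: ideal_prod_assoc[OF L P I] ideal_pow_Suc)
  moreover have "?h \<otimes> x = x \<otimes> ?h"
    using ideal.Icarr[OF LP h] "3.prems" by (simp add: m_comm)
  ultimately have "x \<otimes> ?h \<in> ideal_prod R L (ideal_pow R ?I (Suc n))"
    by simp
  with g show ?case
    using ideal_a_closed[OF LP] by (simp only: form_eval.simps)
qed

lemma forms_eq_ideal_prod:
  assumes L: "ideal L R" and xs: "set xs \<subseteq> carrier R"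
  shows "forms R L xs n = ideal_prod R L (ideal_pow R (Idl (set xs)) n)"
proof
  show "forms R L xs n \<subseteq> ideal_prod R L (ideal_pow R (Idl (set xs)) n)"
    using form_eval_mem[OF L xs] unfolding forms_def by auto
  show "ideal_prod R L (ideal_pow R (Idl (set xs)) n) \<subseteq> forms R L xs n"
  proof (induction n)
    case 0
    then show ?case
      by (simp add: forms_0 ideal_prod_one L)
  next
    case (Suc n)
    have "ideal (Idl (set xs)) R"
      using xs by (rule genideal_ideal)
    then have "ideal_prod R L (ideal_pow R (Idl (set xs)) (Suc n)) =
        ideal_prod R (ideal_prod R L (ideal_pow R (Idl (set xs)) n)) (Idl (set xs))"
      by (simp add: ideal_prod_assoc[OF L ideal_pow_is_ideal])
    also have "\<dots> \<subseteq> forms R L xs (Suc n)"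
      using ideal_prod_mono[OF Suc order_refl] forms_mult_Idl[OF L xs] by blast
    finally show ?case .
  qed
qed

lemma forms_eq_ideal_pow:
  assumes "set xs \<subseteq> carrier R"
  shows "forms R (carrier R) xs n = ideal_pow R (Idl (set xs)) n"
  using assms by (simp add: forms_eq_ideal_prod oneideal ideal_prod_carrier_left ideal_pow_is_ideal genideal_ideal)

text \<open>An element of I^(n+1) is thus a form of degree only \<open>n\<close>, with coefficients
  in I, and can be subtracted coefficientwise from another form of degree \<open>n\<close>.\<close>

lemma forms_Idl_eq_ideal_pow:
  assumes "set xs \<subseteq> carrier R"
  shows "forms R (Idl (set xs)) xs n = ideal_pow R (Idl (set xs)) (Suc n)"
  using assms by (simp add: forms_eq_ideal_prod genideal_ideal ideal_prod_commute ideal_pow_is_ideal)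

section \<open>Powers of a regular sequence\<close>

lemma Idl_insert:
  assumes S: "S \<subseteq> carrier R" and x: "x \<in> carrier R"
  shows "Idl (insert x S) = {k \<oplus> r \<otimes> x | k r. k \<in> Idl S \<and> r \<in> carrier R}" (is "_ = ?K")
proof
  have I: "ideal (Idl S) R" and I': "ideal (Idl (insert x S)) R"
    using S x by (auto intro: genideal_ideal)
  note c = ideal.Icarr[OF I]
  have "ideal ?K R"
  proof (rule is_idealI)
    show "?K \<subseteq> carrier R"
      using c x by auto
    show "\<zero> \<in> ?K"
      using ideal_zero_closed[OF I] x by (intro CollectI exI[of _ \<zero>]) simp
    show "u \<oplus> v \<in> ?K" if uvK: "u \<in> ?K" "v \<in> ?K" for u v
    proof -
      obtain k r l t where uv: "u = k \<oplus> r \<otimes> x" "v = l \<oplus> t \<otimes> x" "k \<in> Idl S" "l \<in> Idl S"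
        "r \<in> carrier R" "t \<in> carrier R"
        using uvK by blast
      then have "u \<oplus> v = (k \<oplus> l) \<oplus> (r \<oplus> t) \<otimes> x"
        using c x by (simp add: l_distr a_ac)
      then show ?thesis
        using uv ideal_a_closed[OF I] by blast
    qed
    show "t \<otimes> u \<in> ?K" if t: "t \<in> carrier R" and uK: "u \<in> ?K" for t u
    proof -
      obtain k r where u: "u = k \<oplus> r \<otimes> x" "k \<in> Idl S" "r \<in> carrier R"
        using uK by blast
      then have "t \<otimes> u = t \<otimes> k \<oplus> (t \<otimes> r) \<otimes> x"
        using t c x by (simp add: r_distr m_assoc)
      then show ?thesis
        using u t ideal.I_l_closed[OF I] by blast
    qed
  qed
  moreover have "insert x S \<subseteq> ?K"
  proof -
    have "x \<in> ?K"
      using x ideal_zero_closed[OF I] by (intro CollectI exI[of _ \<zero>] exI[of _ \<one>]) simp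
    moreover have "y \<in> ?K" if "y \<in> S" for y
      using that S x genideal_self[OF S]
      by (intro CollectI exI[of _ y] exI[of _ \<zero>]) auto
    ultimately show ?thesis
      by blast
  qed
  ultimately show "Idl (insert x S) \<subseteq> ?K"
    by (rule genideal_minimal)
  have "Idl S \<subseteq> Idl (insert x S)" "x \<in> Idl (insert x S)"
    using S x genideal_self[of "insert x S"] by (auto intro: Idl_mono[THEN subsetD])
  then show "?K \<subseteq> Idl (insert x S)"
    using ideal_a_closed[OF I'] ideal.I_l_closed[OF I'] by blast
qed

lemma weakly_regular_cong:
  assumes "Idl S = Idl T" "S \<subseteq> carrier R" "T \<subseteq> carrier R" "set xs \<subseteq> carrier R"
  shows "weakly_regular R S xs \<longleftrightarrow> weakly_regular R T xs"
  using assms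
proof (induction xs arbitrary: S T)
  case (Cons x xs)
  then have "Idl (insert x S) = Idl (insert x T)"
    by (simp add: Idl_insert)
  then show ?case
    using Cons.IH[of "insert x S" "insert x T"] Cons.prems by simp
qed simp

text \<open>
  With \<open>T\<close> generating the colon ideal \<open>(S : y)\<close> there is an exact sequence
  \<open>0 \<rightarrow> R/T \<rightarrow> R/S \<rightarrow> R/(S, y) \<rightarrow> 0\<close>, and regularity passes from the outer terms to the middle one.
\<close>

lemma weakly_regular_colon:
  assumes "weakly_regular R (insert y S) xs" "weakly_regular R T xs"
    and "\<forall>s\<in>carrier R. s \<otimes> y \<in> Idl S \<longleftrightarrow> s \<in> Idl T"
    and "S \<subseteq> carrier R" "T \<subseteq> carrier R" "y \<in> carrier R" "set xs \<subseteq> carrier R"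
  shows "weakly_regular R S xs"
  using assms
proof (induction xs arbitrary: S T)
  case (Cons z xs)
  have z: "z \<in> carrier R" and y: "y \<in> carrier R" and ST: "S \<subseteq> carrier R" "T \<subseteq> carrier R"
    using Cons.prems(4-7) by auto
  have IS: "ideal (Idl S) R" and IT: "ideal (Idl T) R"
    and Iy: "ideal (Idl (insert y S)) R"
    using ST y by (auto intro: genideal_ideal)
  have mono: "Idl S \<subseteq> Idl (insert y S)"
    using ST y by (simp add: Idl_mono subset_insertI)
  have yI: "y \<in> Idl (insert y S)"
    using genideal_self[of "insert y S"] ST y by auto
  note c = ideal.Icarr[OF IS] ideal.Icarr[OF IT]
  have colon: "s \<otimes> y \<in> Idl S \<longleftrightarrow> s \<in> Idl T" if "s \<in> carrier R" for s
    using Cons.prems(3) that by blast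
  have nzd_y: "r \<in> Idl (insert y S)" if "r \<in> carrier R" "z \<otimes> r \<in> Idl (insert y S)" for r
    using Cons.prems(1) that unfolding weakly_regular.simps by blast
  have nzd_T: "r \<in> Idl T" if "r \<in> carrier R" "z \<otimes> r \<in> Idl T" for r
    using Cons.prems(2) that unfolding weakly_regular.simps by blast
  have "r \<in> Idl S" if r: "r \<in> carrier R" "z \<otimes> r \<in> Idl S" for r
  \<comment> \<open>Modulo (S, y) the factor \<open>z\<close> cancels, so \<open>r\<close> is
    \<open>s \<otimes> y\<close> up to (S). Then \<open>z \<otimes> s\<close> lies in the colon
    ideal (T), where \<open>z\<close> cancels again.\<close>
  proof -
    have "r \<in> Idl (insert y S)"
      using nzd_y r mono by blast
    then obtain k s where k: "r = k \<oplus> s \<otimes> y" "k \<in> Idl S" "s \<in> carrier R"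
      using Idl_insert[OF ST(1) y] by auto
    have "z \<otimes> r = z \<otimes> k \<oplus> z \<otimes> s \<otimes> y"
      using k c z y by (simp add: r_distr m_assoc)
    then have "z \<otimes> s \<otimes> y \<in> Idl S"
      using ideal_add_left_cancel[OF IS, of "z \<otimes> k" "z \<otimes> s \<otimes> y"]
        ideal.I_l_closed[OF IS k(2) z] r k y z by simp
    then have "s \<in> Idl T"
      using colon[of "z \<otimes> s"] nzd_T k z by simp
    then show ?thesis
      using k colon ideal_a_closed[OF IS] by simp
  qed
  moreover have "weakly_regular R (insert z S) xs"
  proof (rule Cons.IH)
    show "weakly_regular R (insert y (insert z S)) xs" "weakly_regular R (insert z T) xs"
      using Cons.prems(1,2) unfolding weakly_regular.simps by (simp_all only: insert_commute)
    \<comment> \<open>The colon relation survives adjoining \<open>z\<close>: the exact sequence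
      stays exact modulo \<open>z\<close> since \<open>z\<close> is a nonzerodivisor on R/(S,
      y).\<close>
    show "\<forall>s\<in>carrier R. s \<otimes> y \<in> Idl (insert z S) \<longleftrightarrow> s \<in> Idl (insert z T)"
    proof (intro ballI iffI)
      fix s assume s: "s \<in> carrier R" "s \<otimes> y \<in> Idl (insert z S)"
      then obtain k t where k: "s \<otimes> y = k \<oplus> t \<otimes> z" "k \<in> Idl S" "t \<in> carrier R"
        using Idl_insert[OF ST(1) z] by auto
      have "k \<oplus> z \<otimes> t \<in> Idl (insert y S)"
        using k s z y ideal.I_l_closed[OF Iy yI s(1)] by (simp add: m_comm)
      then have "z \<otimes> t \<in> Idl (insert y S)"
        using ideal_add_left_cancel[OF Iy] k z mono by blast
      then have "t \<in> Idl (insert y S)"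
        using nzd_y k by blast
      then obtain l t' where l: "t = l \<oplus> t' \<otimes> y" "l \<in> Idl S" "t' \<in> carrier R"
        using Idl_insert[OF ST(1) y] by auto
      have kl: "k \<in> carrier R" "l \<in> carrier R"
        using k l c by auto
      \<comment> \<open>Since \<open>t\<close> equals \<open>t' \<otimes> y\<close> modulo (S),
        subtracting \<open>t' \<otimes> z\<close> from \<open>s\<close> removes the multiple of
        \<open>z\<close> from \<open>s \<otimes> y\<close>, leaving an element of (S).\<close>
      have "(s \<ominus> t' \<otimes> z) \<otimes> y = s \<otimes> y \<ominus> t' \<otimes> y \<otimes> z"
        using s y z l by (simp add: a_minus_def l_distr r_distr l_minus r_minus m_ac)
      also have "\<dots> = k \<oplus> l \<otimes> z"
        using kl l z y by (simp add: k(1) l_distr a_minus_def a_assoc r_neg)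
      also have "\<dots> \<in> Idl S"
        using k l z ideal.I_r_closed[OF IS] ideal_a_closed[OF IS] by simp
      finally have "s \<ominus> t' \<otimes> z \<in> Idl T"
        using colon s l z by simp
      moreover have "s = (s \<ominus> t' \<otimes> z) \<oplus> t' \<otimes> z"
        using s l z by (simp add: a_minus_def a_assoc l_neg)
      ultimately show "s \<in> Idl (insert z T)"
        unfolding Idl_insert[OF ST(2) z] using l by blast
    next
      fix s assume "s \<in> carrier R" "s \<in> Idl (insert z T)"
      then obtain k t where k: "s = k \<oplus> t \<otimes> z" "k \<in> Idl T" "t \<in> carrier R"
        using Idl_insert[OF ST(2) z] by auto
      then have "s \<otimes> y = k \<otimes> y \<oplus> (t \<otimes> y) \<otimes> z"
        using c y z by (simp add: l_distr r_distr m_ac)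
      moreover have "k \<otimes> y \<in> Idl S"
        using colon k c by simp
      ultimately show "s \<otimes> y \<in> Idl (insert z S)"
        unfolding Idl_insert[OF ST(1) z] using k y by blast
    qed
  qed (use ST y z Cons.prems(7) in auto)
  ultimately show ?case
    unfolding weakly_regular.simps by blast
qed simp

lemma nonzerodivisor_pow:
  assumes x: "x \<in> carrier R"
    and "\<forall>r\<in>carrier R. x \<otimes> r \<in> K \<longrightarrow> r \<in> K"
    and "r \<in> carrier R" "x [^] (e::nat) \<otimes> r \<in> K"
  shows "r \<in> K"
  using assms(3,4)
proof (induction e arbitrary: r)
  case (Suc e)
  then have "x \<otimes> r \<in> K"
    using x by (simp add: m_assoc)
  then show ?case
    using assms(2) Suc.prems by blast
qed simp

text \<open>Induction on the exponent through \<open>weakly_regular_colon\<close>, with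
  \<open>y\<close> the previous power of \<open>x\<close>. Adjoining \<open>y\<close> to the next
  power gives the ideal of the induction hypothesis, and the colon ideal is (S, x) because
  \<open>x\<close> cancels modulo (S).\<close>

lemma weakly_regular_insert_pow:
  assumes S: "S \<subseteq> carrier R" and x: "x \<in> carrier R" and xs: "set xs \<subseteq> carrier R"
    and nzd: "\<forall>r\<in>carrier R. x \<otimes> r \<in> Idl S \<longrightarrow> r \<in> Idl S"
    and reg: "weakly_regular R (insert x S) xs"
  shows "weakly_regular R (insert (x [^] Suc e) S) xs"
proof (induction e)
  case 0
  then show ?case
    using reg x by simp
next
  case (Suc e)
  let ?y = "x [^] Suc e" and ?z = "x [^] Suc (Suc e)"
  have y: "?y \<in> carrier R" and z: "?z \<in> carrier R"
    using x by auto
  have zy: "?z = x \<otimes> ?y"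
    using x by (simp add: m_comm)
  have IS: "ideal (Idl S) R" and Iy: "ideal (Idl (insert ?y S)) R"
    using S y by (auto intro!: genideal_ideal simp del: nat_pow_Suc)
  note c = ideal.Icarr[OF IS]
  show ?case
  proof (rule weakly_regular_colon[of ?y _ _ "insert x S"])
    \<comment> \<open>The higher power is a redundant generator once the lower one is
      present.\<close>
    have "insert ?y (insert ?z S) \<subseteq> Idl (insert ?y S)"
      using genideal_self[of "insert ?y S"] ideal.I_l_closed[OF Iy _ x, of ?y] S y zy
      by (simp del: nat_pow_Suc)
    then have "Idl (insert ?y (insert ?z S)) = Idl (insert ?y S)"
      using Iy S y z by (intro equalityI genideal_minimal Idl_mono) auto
    then show "weakly_regular R (insert ?y (insert ?z S)) xs"
      using Suc S y z xs weakly_regular_cong[of "insert ?y (insert ?z S)" "insert ?y S" xs]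
      by (simp del: nat_pow_Suc)
    show "\<forall>s\<in>carrier R. s \<otimes> ?y \<in> Idl (insert ?z S) \<longleftrightarrow> s \<in> Idl (insert x S)"
    proof (intro ballI iffI)
      fix s assume s: "s \<in> carrier R" "s \<otimes> ?y \<in> Idl (insert ?z S)"
      then obtain k t where k: "s \<otimes> ?y = k \<oplus> t \<otimes> ?z" "k \<in> Idl S" "t \<in> carrier R"
        using Idl_insert[OF S z] by auto
      \<comment> \<open>Both sides of the equation for \<open>k\<close> share the factor
        \<open>?y\<close>, a power of \<open>x\<close>, which can be cancelled modulo (S).\<close>
      have "?y \<otimes> (s \<ominus> t \<otimes> x) = s \<otimes> ?y \<ominus> t \<otimes> ?z"
        unfolding zy using s k x y
        by (simp del: nat_pow_Suc add: a_minus_def r_distr r_minus m_ac)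
      also have "\<dots> = k"
        unfolding k(1) using k(2,3) c z by (simp del: nat_pow_Suc add: a_minus_def a_assoc r_neg)
      finally have "s \<ominus> t \<otimes> x \<in> Idl S"
        using k(2,3) s x nonzerodivisor_pow[OF x nzd, of "s \<ominus> t \<otimes> x" "Suc e"]
        by (simp del: nat_pow_Suc)
      moreover have "s = (s \<ominus> t \<otimes> x) \<oplus> t \<otimes> x"
        using s k x by (simp add: a_minus_def a_assoc l_neg)
      ultimately show "s \<in> Idl (insert x S)"
        unfolding Idl_insert[OF S x] using k by blast
    next
      fix s assume "s \<in> carrier R" "s \<in> Idl (insert x S)"
      then obtain k t where k: "s = k \<oplus> t \<otimes> x" "k \<in> Idl S" "t \<in> carrier R"
        using Idl_insert[OF S x] by auto
      then have "s \<otimes> ?y = k \<otimes> ?y \<oplus> t \<otimes> ?z"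
        unfolding zy using c x y by (simp del: nat_pow_Suc add: l_distr r_distr m_ac)
      moreover have "k \<otimes> ?y \<in> Idl S"
        using k y by (intro ideal.I_r_closed[OF IS])
      ultimately show "s \<otimes> ?y \<in> Idl (insert ?z S)"
        unfolding Idl_insert[OF S z] using k by blast
    qed
  qed (use S x xs reg in simp_all)
qed

text \<open>The head is replaced by its power first, which for the tail only changes the base set;
  the induction hypothesis, being general in \<open>S\<close>, then replaces the rest.\<close>

lemma weakly_regular_map_pow:
  assumes "weakly_regular R S xs" "S \<subseteq> carrier R" "set xs \<subseteq> carrier R" "(q::nat) > 0"
  shows "weakly_regular R S (map (\<lambda>x. x [^] q) xs)"
  using assms(1-3)
proof (induction xs arbitrary: S)
  case (Cons x xs)
  obtain e where e: "q = Suc e"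
    using \<open>q > 0\<close> by (cases q) auto
  have c: "S \<subseteq> carrier R" "x \<in> carrier R" "set xs \<subseteq> carrier R"
    using Cons.prems by auto
  have nzd: "\<forall>r\<in>carrier R. x \<otimes> r \<in> Idl S \<longrightarrow> r \<in> Idl S"
    and reg: "weakly_regular R (insert x S) xs"
    using Cons.prems(1) unfolding weakly_regular.simps by blast+
  have "weakly_regular R (insert (x [^] q) S) (map (\<lambda>x. x [^] q) xs)"
    using Cons.IH weakly_regular_insert_pow[OF c nzd reg, of e] c unfolding e by blast
  moreover have "\<forall>r\<in>carrier R. x [^] q \<otimes> r \<in> Idl S \<longrightarrow> r \<in> Idl S"
    using nonzerodivisor_pow[OF c(2) nzd] by blast
  ultimately show ?case
    unfolding list.map weakly_regular.simps by blast
qed simp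

section \<open>Quasi-regularity\<close>

text \<open>Reduces quasi-regularity in a fixed degree to forms with value zero: an element of
  I^(n+1) is also the value of a form of degree \<open>n\<close> with coefficients in I, and the
  difference of the two forms vanishes.\<close>

lemma coefficients_mem_of_zero_form:
  assumes xs: "set xs \<subseteq> carrier R"
    and zero: "\<And>a. \<forall>\<alpha>. a \<alpha> \<in> carrier R \<Longrightarrow> form_eval R xs n a = \<zero> \<Longrightarrow>
      \<forall>\<alpha>\<in>monomials xs n. a \<alpha> \<in> Idl (set xs)"
    and a: "\<forall>\<alpha>. a \<alpha> \<in> carrier R"
    and mem: "form_eval R xs n a \<in> ideal_pow R (Idl (set xs)) (Suc n)"
  shows "\<forall>\<alpha>\<in>monomials xs n. a \<alpha> \<in> Idl (set xs)"
proof
  fix \<alpha> assume \<alpha>: "\<alpha> \<in> monomials xs n"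
  have I: "ideal (Idl (set xs)) R"
    using xs by (rule genideal_ideal)
  obtain b where b: "form_eval R xs n a = form_eval R xs n b" "\<forall>\<alpha>. b \<alpha> \<in> Idl (set xs)"
    using mem unfolding forms_Idl_eq_ideal_pow[OF xs, symmetric] forms_def by blast
  have bc: "\<forall>\<alpha>. b \<alpha> \<in> carrier R"
    using b ideal.Icarr[OF I] by blast
  have "form_eval R xs n (\<lambda>\<alpha>. a \<alpha> \<ominus> b \<alpha>) = \<zero>"
    using form_eval_minus[OF xs a bc] b form_eval_closed[OF xs bc]
    by (simp add: a_minus_def r_neg)
  then have "a \<alpha> \<ominus> b \<alpha> \<in> Idl (set xs)"
    using zero[of "\<lambda>\<alpha>. a \<alpha> \<ominus> b \<alpha>"] a bc \<alpha> by simp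
  then have "(a \<alpha> \<ominus> b \<alpha>) \<oplus> b \<alpha> \<in> Idl (set xs)"
    using b ideal_a_closed[OF I] by blast
  then show "a \<alpha> \<in> Idl (set xs)"
    using a bc by (simp add: a_minus_def a_assoc l_neg)
qed

text \<open>For J generated by a quasi-regular sequence, each J^m/J^(m+1) is free over R/J, so
  cancelling \<open>x\<close> passes from J to its powers. Concretely, \<open>r\<close> is in J^m by
  induction, and quasi-regularity puts \<open>x\<close> times each of its coefficients into J, hence
  the coefficients themselves.\<close>

lemma nonzerodivisor_mod_ideal_pow:
  assumes qr: "quasi_regular R xs" and xs: "set xs \<subseteq> carrier R" and x: "x \<in> carrier R"
    and nzd: "\<forall>r\<in>carrier R. x \<otimes> r \<in> Idl (set xs) \<longrightarrow> r \<in> Idl (set xs)"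
    and "r \<in> carrier R" "x \<otimes> r \<in> ideal_pow R (Idl (set xs)) m"
  shows "r \<in> ideal_pow R (Idl (set xs)) m"
  using assms(5,6)
proof (induction m)
  case 0
  then show ?case
    by simp
next
  case (Suc m)
  let ?J = "Idl (set xs)"
  have J: "ideal ?J R"
    using xs by (rule genideal_ideal)
  have "x \<otimes> r \<in> ideal_pow R ?J m"
    using Suc.prems(2) ideal_prod_inter[OF ideal_pow_is_ideal[OF J] J]
    unfolding ideal_pow_Suc by blast
  then have "r \<in> forms R (carrier R) xs m"
    using Suc.IH Suc.prems(1) forms_eq_ideal_pow[OF xs] by blast
  then obtain a where a: "r = form_eval R xs m a" "\<forall>\<alpha>. a \<alpha> \<in> carrier R"
    unfolding forms_def by blast
  have "form_eval R xs m (\<lambda>\<alpha>. x \<otimes> a \<alpha>) \<in> ideal_pow R ?J (Suc m)"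
    unfolding form_eval_smult[OF xs a(2) x] a(1)[symmetric] by (rule Suc.prems(2))
  then have "\<forall>\<alpha>\<in>monomials xs m. x \<otimes> a \<alpha> \<in> ?J"
    by (rule quasi_regularD[OF qr, rotated]) (use a(2) x in simp)
  then have "\<forall>\<alpha>\<in>monomials xs m. a \<alpha> \<in> ?J"
    using nzd a(2) by blast
  then have "form_eval R xs m a \<in> ideal_prod R ?J (ideal_pow R ?J m)"
    by (rule form_eval_mem[OF J xs])
  then show ?case
    unfolding ideal_pow_Suc a(1) ideal_prod_commute[OF ideal_pow_is_ideal[OF J] J] .
qed

text \<open>The list is reversed because forms split off the head variable, which has to be the last
  element of the regular sequence.\<close>

lemma weakly_regular_imp_quasi_regular:
  assumes "weakly_regular R {} (rev xs)" "set xs \<subseteq> carrier R"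
  shows "quasi_regular R xs"
  using assms
proof (induction xs)
  case Nil
  have zero: "\<forall>\<alpha>\<in>monomials ([] :: 'a list) n. a \<alpha> \<in> Idl (set [])" if "form_eval R [] n a = \<zero>" for n a
    using that ideal_zero_closed[OF genideal_ideal] by (cases n) auto
  show ?case
    unfolding quasi_regular_def
  proof (intro allI impI)
    fix n a
    assume a: "\<forall>\<alpha>. a \<alpha> \<in> carrier R"
      and mem: "form_eval R [] n a \<in> ideal_pow R (Idl (set [])) (Suc n)"
    show "\<forall>\<alpha>\<in>monomials ([] :: 'a list) n. a \<alpha> \<in> Idl (set [])"
      by (rule coefficients_mem_of_zero_form[OF Nil.prems(2) _ a mem], rule zero)
  qed
next
  case (Cons x xs)
  let ?J = "Idl (set xs)" and ?I = "Idl (set (x # xs))"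
  have x: "x \<in> carrier R" and xs: "set xs \<subseteq> carrier R" and xxs: "set (x # xs) \<subseteq> carrier R"
    using Cons.prems by auto
  have "weakly_regular R {} (rev xs @ [x])"
    using Cons.prems by simp
  then have reg: "weakly_regular R {} (rev xs)"
    and nzd: "\<forall>r\<in>carrier R. x \<otimes> r \<in> ?J \<longrightarrow> r \<in> ?J"
    unfolding weakly_regular_snoc set_rev Un_empty_left by blast+
  have qr: "quasi_regular R xs"
    using reg xs by (rule Cons.IH)
  have J: "ideal ?J R" and I: "ideal ?I R"
    using xs xxs by (auto intro!: genideal_ideal)
  have JI: "?J \<subseteq> ?I"
    using xxs by (intro Idl_mono) auto
  have xI: "x \<in> ?I"
    using genideal_self[OF xxs] by simp
  \<comment> \<open>Forms of value zero suffice; they are treated by an inner induction on the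
    degree, for the fixed list \<open>x # xs\<close>.\<close>
  have zero: "\<forall>\<alpha>\<in>monomials (x # xs) n. a \<alpha> \<in> ?I"
    if "\<forall>\<alpha>. a \<alpha> \<in> carrier R" "form_eval R (x # xs) n a = \<zero>" for n a
    using that
  proof (induction n arbitrary: a)
    case 0
    then show ?case
      using ideal_zero_closed[OF I] by simp
  next
    case (Suc n)
    let ?g = "form_eval R xs (Suc n) (\<lambda>\<alpha>. a (False # \<alpha>))"
    let ?h = "form_eval R (x # xs) n (\<lambda>\<alpha>. a (True # \<alpha>))"
    have hc: "?h \<in> carrier R"
      by (rule form_eval_closed; use xxs Suc.prems(1) in blast)
    have sum: "?g \<oplus> x \<otimes> ?h = \<zero>"
      using Suc.prems(2) by simp
    have P: "ideal (ideal_pow R ?J (Suc n)) R"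
      using J by (rule ideal_pow_is_ideal)
    have g: "?g \<in> ideal_pow R ?J (Suc n)"
      unfolding forms_eq_ideal_pow[OF xs, symmetric] forms_def using Suc.prems(1) by blast
    \<comment> \<open>As \<open>?g\<close> is a form in \<open>xs\<close> alone, so is
      \<open>x \<otimes> ?h\<close> up to sign, and \<open>x\<close> cancels modulo the powers of
      \<open>?J\<close>. This raises the order of \<open>?h\<close> from \<open>n\<close> to
      \<open>Suc n\<close>.\<close>
    have "x \<otimes> ?h \<in> ideal_pow R ?J (Suc n)"
      by (rule ideal_add_left_cancel[OF P g m_closed[OF x hc]])
        (unfold sum, rule ideal_zero_closed[OF P])
    then have h: "?h \<in> ideal_pow R ?J (Suc n)"
      by (rule nonzerodivisor_mod_ideal_pow[OF qr xs x nzd hc])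
    then have hI: "?h \<in> ideal_pow R ?I (Suc n)"
      using ideal_pow_mono[OF JI] by blast
    \<comment> \<open>The induction hypothesis speaks of forms of value zero;
      \<open>coefficients_mem_of_zero_form\<close> extends it to \<open>?h\<close>, whose value lies
      in the power \<open>Suc n\<close> of \<open>?I\<close>.\<close>
    have T: "\<forall>\<alpha>\<in>monomials (x # xs) n. a (True # \<alpha>) \<in> ?I"
      by (rule coefficients_mem_of_zero_form[OF xxs Suc.IH _ hI]) (use Suc.prems(1) in auto)
    \<comment> \<open>Rewriting \<open>?h\<close> in the variables \<open>xs\<close> alone turns the
      whole sum into one form in \<open>xs\<close> of value zero. Quasi-regularity of
      \<open>xs\<close> puts its coefficients into \<open>?J\<close>, and the correction
      \<open>x \<otimes> b \<alpha>\<close> lies in \<open>?I\<close>.\<close>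
    obtain b where b: "?h = form_eval R xs (Suc n) b" "\<forall>\<alpha>. b \<alpha> \<in> carrier R"
      using h unfolding forms_eq_ideal_pow[OF xs, symmetric] forms_def by blast
    have c: "\<forall>\<alpha>. a (False # \<alpha>) \<in> carrier R" "\<forall>\<alpha>. x \<otimes> b \<alpha> \<in> carrier R"
      using Suc.prems(1) b(2) x by simp_all
    have "form_eval R xs (Suc n) (\<lambda>\<alpha>. a (False # \<alpha>) \<oplus> x \<otimes> b \<alpha>) =
        ?g \<oplus> x \<otimes> form_eval R xs (Suc n) b"
      by (simp only: form_eval_add[OF xs c] form_eval_smult[OF xs b(2) x])
    also have "\<dots> = \<zero>"
      unfolding b(1)[symmetric] by (rule sum)
    also have "\<dots> \<in> ideal_pow R ?J (Suc (Suc n))"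
      by (rule ideal_zero_closed[OF ideal_pow_is_ideal[OF J]])
    finally have "\<forall>\<alpha>\<in>monomials xs (Suc n). a (False # \<alpha>) \<oplus> x \<otimes> b \<alpha> \<in> ?J"
      by (rule quasi_regularD[OF qr, rotated]) (use c in simp)
    moreover have "a (False # \<alpha>) \<in> ?I" if "a (False # \<alpha>) \<oplus> x \<otimes> b \<alpha> \<in> ?J" for \<alpha>
    proof (rule ideal_add_left_cancel[OF I])
      show "x \<otimes> b \<alpha> \<in> ?I"
        using b(2) by (intro ideal.I_r_closed[OF I xI]) blast
      have "x \<otimes> b \<alpha> \<oplus> a (False # \<alpha>) = a (False # \<alpha>) \<oplus> x \<otimes> b \<alpha>"
        using Suc.prems(1) b(2) x by (simp add: a_comm)
      then show "x \<otimes> b \<alpha> \<oplus> a (False # \<alpha>) \<in> ?I"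
        using that JI by auto
    qed (use Suc.prems(1) in blast)
    ultimately show ?case
      using T unfolding monomials.simps by blast
  qed
  show ?case
    unfolding quasi_regular_def
  proof (intro allI impI)
    fix n a
    assume a: "\<forall>\<alpha>. a \<alpha> \<in> carrier R"
      and mem: "form_eval R (x # xs) n a \<in> ideal_pow R ?I (Suc n)"
    show "\<forall>\<alpha>\<in>monomials (x # xs) n. a \<alpha> \<in> ?I"
      by (rule coefficients_mem_of_zero_form[OF xxs _ a mem], rule zero)
  qed
qed

section \<open>Frobenius powers and tight closure\<close>

lemma binomial_theorem:
  assumes a: "a \<in> carrier R" and b: "b \<in> carrier R"
  shows "(a \<oplus> b) [^] (m::nat) = (\<Oplus>k\<in>{..m}. [(m choose k)] \<cdot> (a [^] k \<otimes> b [^] (m - k)))"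
proof (induction m)
  case 0
  then show ?case
    by simp
next
  case (Suc m)
  let ?t = "\<lambda>m k. [(m choose k)] \<cdot> (a [^] k \<otimes> b [^] (m - k))"
  let ?u = "\<lambda>k. [(m choose k)] \<cdot> (a [^] k \<otimes> b [^] (Suc m - k))"
  let ?v = "\<lambda>k. [(m choose k)] \<cdot> (a [^] Suc k \<otimes> b [^] (m - k))"
  have S: "(\<Oplus>k\<in>{..m}. ?t m k) \<in> carrier R"
    using a b by (intro finsum_closed) auto
  have "(\<Oplus>k\<in>{..m}. ?t m k) \<otimes> a = (\<Oplus>k\<in>{..m}. ?t m k \<otimes> a)"
    using a b by (intro finsum_ldistr) auto
  also have "\<dots> = (\<Oplus>k\<in>{..m}. ?v k)"
    using a b by (intro finsum_cong') (auto simp: add_pow_ldistr add_pow_rdistr m_ac)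
  finally have va: "(\<Oplus>k\<in>{..m}. ?t m k) \<otimes> a = (\<Oplus>k\<in>{..m}. ?v k)" .
  have "(\<Oplus>k\<in>{..m}. ?t m k) \<otimes> b = (\<Oplus>k\<in>{..m}. ?t m k \<otimes> b)"
    using a b by (intro finsum_ldistr) auto
  also have "\<dots> = (\<Oplus>k\<in>{..m}. ?u k)"
    using a b by (intro finsum_cong') (auto simp: add_pow_ldistr m_assoc Suc_diff_le)
  \<comment> \<open>The added term has coefficient \<open>m choose Suc m\<close>, which is 0.
    Splitting off \<open>k = 0\<close> then shifts the index so that Pascal's rule applies against
    \<open>?v\<close>.\<close>
  also have "\<dots> = (\<Oplus>k\<in>{..Suc m}. ?u k)"
    using a b by (subst finsum_Suc) (auto simp: binomial_eq_0)
  also have "\<dots> = (\<Oplus>k\<in>{..m}. ?u (Suc k)) \<oplus> ?u 0"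
    using a b by (subst finsum_Suc2) auto
  finally have ub: "(\<Oplus>k\<in>{..m}. ?t m k) \<otimes> b = (\<Oplus>k\<in>{..m}. ?u (Suc k)) \<oplus> ?u 0" .
  have "(a \<oplus> b) [^] Suc m = (\<Oplus>k\<in>{..m}. ?t m k) \<otimes> a \<oplus> (\<Oplus>k\<in>{..m}. ?t m k) \<otimes> b"
    using Suc S a b by (simp add: r_distr)
  also have "\<dots> = ((\<Oplus>k\<in>{..m}. ?v k) \<oplus> (\<Oplus>k\<in>{..m}. ?u (Suc k))) \<oplus> ?u 0"
    unfolding va ub using a b by (intro a_assoc[symmetric] finsum_closed) auto
  also have "(\<Oplus>k\<in>{..m}. ?v k) \<oplus> (\<Oplus>k\<in>{..m}. ?u (Suc k)) = (\<Oplus>k\<in>{..m}. ?v k \<oplus> ?u (Suc k))"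
    using a b by (intro finsum_addf[symmetric]) auto
  also have "\<dots> = (\<Oplus>k\<in>{..m}. ?t (Suc m) (Suc k))"
    using a b by (intro finsum_cong') (auto simp: add.nat_pow_mult simp del: nat_pow_Suc)
  also have "(\<Oplus>k\<in>{..m}. ?t (Suc m) (Suc k)) \<oplus> ?u 0 = (\<Oplus>k\<in>{..Suc m}. ?t (Suc m) k)"
    using a b by (subst finsum_Suc2) auto
  finally show ?case .
qed

lemma freshmans_dream:
  assumes p: "Factorial_Ring.prime (p::nat)" and char: "[p] \<cdot> \<one> = \<zero>"
    and a: "a \<in> carrier R" and b: "b \<in> carrier R"
  shows "(a \<oplus> b) [^] p = a [^] p \<oplus> b [^] p"
proof -
  \<comment> \<open>With p = m + 2, removing the two end terms leaves exactly the indices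
    \<open>Suc k\<close> with \<open>k \<le> m\<close>, whose binomial coefficients are divisible by
    p.\<close>
  obtain m where m: "p = Suc (Suc m)"
    using prime_ge_2_nat[OF p] by (metis add_2_eq_Suc le_Suc_ex)
  let ?t = "\<lambda>k. [(p choose k)] \<cdot> (a [^] k \<otimes> b [^] (p - k))"
  have char': "[p] \<cdot> x = \<zero>" if "x \<in> carrier R" for x
    using add_pow_ldistr[OF one_closed that, of p] char that by simp
  have "?t (Suc k) = \<zero>" if k: "k \<le> m" for k
  proof -
    have "p dvd (p choose Suc k)"
      using p k m by (intro dvd_choose_prime) auto
    then obtain l where "p choose Suc k = p * l"
      by blast
    moreover have "[(p * l)] \<cdot> x = \<zero>" if "x \<in> carrier R" for x
      using add.nat_pow_pow[OF that, of l p] char'[OF that] by simp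
    ultimately show ?thesis
      using a b by simp
  qed
  then have middle: "(\<Oplus>k\<in>{..m}. ?t (Suc k)) = \<zero>"
    by (intro add.finprod_one_eqI) auto
  have t: "?t \<in> A \<rightarrow> carrier R" for A
    using a b by auto
  have "(a \<oplus> b) [^] p = (\<Oplus>k\<in>{..Suc (Suc m)}. ?t k)"
    using binomial_theorem[OF a b, of p] m by simp
  also have "\<dots> = ?t (Suc (Suc m)) \<oplus> (\<Oplus>k\<in>{..Suc m}. ?t k)"
    by (rule finsum_Suc[OF t])
  also have "(\<Oplus>k\<in>{..Suc m}. ?t k) = (\<Oplus>k\<in>{..m}. ?t (Suc k)) \<oplus> ?t 0"
    by (rule finsum_Suc2[OF t])
  also have "\<dots> = b [^] p"
    unfolding middle using b by simp
  also have "?t (Suc (Suc m)) = a [^] p"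
    unfolding m[symmetric] using a by simp
  finally show ?thesis .
qed

lemma freshmans_dream_pow:
  assumes p: "Factorial_Ring.prime (p::nat)" and char: "[p] \<cdot> \<one> = \<zero>"
    and "a \<in> carrier R" "b \<in> carrier R"
  shows "(a \<oplus> b) [^] (p ^ e) = a [^] (p ^ e) \<oplus> b [^] (p ^ e)"
proof (induction e)
  case (Suc e)
  have "x [^] (p ^ Suc e) = (x [^] (p ^ e)) [^] p" if "x \<in> carrier R" for x
    using that by (simp add: nat_pow_pow mult.commute)
  then show ?case
    using assms Suc freshmans_dream[OF p char] by simp
qed (use assms in simp)

section \<open>Tight closure is an ideal and respects products\<close>

lemma ring_circ_one: "\<one> \<in> ring_circ R"
  unfolding ring_circ_def minimal_prime_def
  using ideal.one_imp_carrier primeideal.axioms(1) primeideal.I_notcarr by fastforce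

lemma ring_circ_mult: "c \<in> ring_circ R \<Longrightarrow> d \<in> ring_circ R \<Longrightarrow> c \<otimes> d \<in> ring_circ R"
  unfolding ring_circ_def minimal_prime_def
  using primeideal.I_prime by fastforce

lemma frobenius_power_ideal: "J \<subseteq> carrier R \<Longrightarrow> ideal (frobenius_power R J q) R"
  unfolding frobenius_power_def by (intro genideal_ideal) auto

lemma tight_closureI:
  assumes "x \<in> carrier R" "c \<in> ring_circ R"
    and "\<And>e. e \<ge> e\<^sub>0 \<Longrightarrow> c \<otimes> x [^] (p ^ e) \<in> frobenius_power R J (p ^ e)"
  shows "x \<in> tight_closure R p J"
  using assms unfolding tight_closure_def by blast

lemma tight_closureE:
  assumes "x \<in> tight_closure R p J"
  obtains c e\<^sub>0 where "x \<in> carrier R" "c \<in> ring_circ R" "c \<in> carrier R"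
    "\<And>e. e \<ge> e\<^sub>0 \<Longrightarrow> c \<otimes> x [^] (p ^ e) \<in> frobenius_power R J (p ^ e)"
  using assms unfolding tight_closure_def ring_circ_def by blast

text \<open>For a sum, the product of the two multipliers and the larger of the two thresholds work,
  since Frobenius is additive. For a multiple of \<open>x\<close>, the multiplier and threshold of
  \<open>x\<close> remain valid.\<close>

lemma tight_closure_ideal:
  assumes p: "Factorial_Ring.prime p" and char: "[p] \<cdot> \<one> = \<zero>" and J: "J \<subseteq> carrier R"
  shows "ideal (tight_closure R p J) R"
proof (rule is_idealI)
  note F = frobenius_power_ideal[OF J]
  show "tight_closure R p J \<subseteq> carrier R"
    unfolding tight_closure_def by blast
  have "\<zero> [^] (p ^ e) = \<zero>" for e
    using prime_gt_0_nat[OF p] by (intro nat_pow_zero) simp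
  then show "\<zero> \<in> tight_closure R p J"
    by (intro tight_closureI[of _ "\<one>"]) (auto simp: ring_circ_one ideal_zero_closed[OF F])
  fix x assume "x \<in> tight_closure R p J"
  then obtain c e\<^sub>0 where x: "x \<in> carrier R" and c: "c \<in> ring_circ R" "c \<in> carrier R"
    and cx: "\<And>e. e \<ge> e\<^sub>0 \<Longrightarrow> c \<otimes> x [^] (p ^ e) \<in> frobenius_power R J (p ^ e)"
    by (rule tight_closureE) blast
  {
    fix y assume "y \<in> tight_closure R p J"
    then obtain d e\<^sub>1 where y: "y \<in> carrier R" and d: "d \<in> ring_circ R" "d \<in> carrier R"
      and dy: "\<And>e. e \<ge> e\<^sub>1 \<Longrightarrow> d \<otimes> y [^] (p ^ e) \<in> frobenius_power R J (p ^ e)"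
      by (rule tight_closureE) blast
    show "x \<oplus> y \<in> tight_closure R p J"
    proof (rule tight_closureI)
      show "x \<oplus> y \<in> carrier R" "c \<otimes> d \<in> ring_circ R"
        using x y c d by (simp_all add: ring_circ_mult)
      fix e assume e: "e \<ge> max e\<^sub>0 e\<^sub>1"
      let ?q = "p ^ e"
      have "c \<otimes> d \<otimes> (x \<oplus> y) [^] ?q = d \<otimes> (c \<otimes> x [^] ?q) \<oplus> c \<otimes> (d \<otimes> y [^] ?q)"
        unfolding freshmans_dream_pow[OF p char x y] using x y c d by (simp add: r_distr m_ac)
      also have "\<dots> \<in> frobenius_power R J ?q"
        using ideal.I_l_closed[OF F cx d(2)] ideal.I_l_closed[OF F dy c(2)] e
        by (simp add: ideal_a_closed[OF F])
      finally show "c \<otimes> d \<otimes> (x \<oplus> y) [^] ?q \<in> frobenius_power R J ?q" .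
    qed
  next
    fix r assume r: "r \<in> carrier R"
    show "r \<otimes> x \<in> tight_closure R p J"
    proof (rule tight_closureI)
      show "r \<otimes> x \<in> carrier R" "c \<in> ring_circ R"
        using r x c by simp_all
      fix e assume e: "e \<ge> e\<^sub>0"
      have "c \<otimes> (r \<otimes> x) [^] (p ^ e) = r [^] (p ^ e) \<otimes> (c \<otimes> x [^] (p ^ e))"
        using r x c by (simp add: nat_pow_distrib m_ac)
      also have "\<dots> \<in> frobenius_power R J (p ^ e)"
        using ideal.I_l_closed[OF F cx[OF e]] r by simp
      finally show "c \<otimes> (r \<otimes> x) [^] (p ^ e) \<in> frobenius_power R J (p ^ e)" .
    qed
  }
qed

text \<open>The multiplier of \<open>b\<close> serves for \<open>a \<otimes> b\<close> too, because
  \<open>a [^] q\<close> carries the Frobenius power of \<open>J\<close> into that of the product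
  ideal. This yields the easy inclusion of the theorem.\<close>

lemma mult_tight_closure_mem:
  assumes I: "I \<subseteq> carrier R" and J: "J \<subseteq> carrier R"
    and a: "a \<in> I" and b: "b \<in> tight_closure R p J"
  shows "a \<otimes> b \<in> tight_closure R p (ideal_prod R I J)"
proof -
  have IJ: "ideal_prod R I J \<subseteq> carrier R"
  proof
    fix u assume "u \<in> ideal_prod R I J"
    then show "u \<in> carrier R"
      by induction (use I J in auto)
  qed
  obtain c e\<^sub>0 where bc: "b \<in> carrier R" and c: "c \<in> ring_circ R" "c \<in> carrier R"
    and cb: "\<And>e. e \<ge> e\<^sub>0 \<Longrightarrow> c \<otimes> b [^] (p ^ e) \<in> frobenius_power R J (p ^ e)"
    using b by (rule tight_closureE) blast
  have ac: "a \<in> carrier R"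
    using a I by blast
  show ?thesis
  proof (rule tight_closureI)
    show "a \<otimes> b \<in> carrier R" "c \<in> ring_circ R"
      using ac bc c by simp_all
    fix e assume e: "e \<ge> e\<^sub>0"
    let ?q = "p ^ e"
    let ?F = "frobenius_power R (ideal_prod R I J) ?q"
    have F: "ideal ?F R"
      using IJ by (rule frobenius_power_ideal)
    \<comment> \<open>The colon of \<open>?F\<close> by \<open>a [^] ?q\<close> is an ideal, so only
      the generating \<open>?q\<close>-th powers of elements of \<open>J\<close> have to be
      checked.\<close>
    let ?K = "{z \<in> carrier R. a [^] ?q \<otimes> z \<in> ?F}"
    have "ideal ?K R"
    proof (rule is_idealI)
      show "\<zero> \<in> ?K"
        using ac ideal_zero_closed[OF F] by simp
      show "x \<oplus> y \<in> ?K" if "x \<in> ?K" "y \<in> ?K" for x y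
        using that ac by (simp add: r_distr ideal_a_closed[OF F])
      show "r \<otimes> x \<in> ?K" if "r \<in> carrier R" "x \<in> ?K" for r x
        using that ac ideal.I_l_closed[OF F] by (simp add: m_lcomm)
    qed blast
    moreover have "(\<lambda>x. x [^] ?q) ` J \<subseteq> ?K"
    proof (rule image_subsetI)
      fix j assume j: "j \<in> J"
      have "(a \<otimes> j) [^] ?q \<in> (\<lambda>x. x [^] ?q) ` ideal_prod R I J"
        using ideal_prod.prod[OF a j] by (rule imageI)
      then have "(a \<otimes> j) [^] ?q \<in> ?F"
        unfolding frobenius_power_def using IJ genideal_self[of "(\<lambda>x. x [^] ?q) ` ideal_prod R I J"]
        by blast
      then show "j [^] ?q \<in> ?K"
        using ac j J by (auto simp: nat_pow_distrib)
    qed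
    ultimately have "frobenius_power R J ?q \<subseteq> ?K"
      unfolding frobenius_power_def by (rule genideal_minimal)
    then have "a [^] ?q \<otimes> (c \<otimes> b [^] ?q) \<in> ?F"
      using cb[OF e] by blast
    then show "c \<otimes> (a \<otimes> b) [^] ?q \<in> ?F"
      using ac bc c by (simp add: nat_pow_distrib m_lcomm)
  qed
qed

section \<open>From regular sequences to coefficients in the tight closure\<close>

lemma regular_sequence_imp_weakly_regular:
  assumes "regular_sequence R xs"
  shows "weakly_regular R {} xs"
  unfolding weakly_regular_iff_nth
proof (intro allI ballI impI)
  fix i r
  let ?J = "Idl ({} \<union> set (take i xs))"
  assume i: "i < length xs" and r: "r \<in> carrier R" and mem: "xs ! i \<otimes> r \<in> ?J"
  have xs: "set xs \<subseteq> carrier R"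
    using assms unfolding regular_sequence_def by blast
  then have J: "ideal ?J R"
    using set_take_subset[of i xs] by (intro genideal_ideal) auto
  have xi: "xs ! i \<in> carrier R"
    using xs i nth_mem by blast
  have nzd: "nonzerodivisor (R Quot ?J) (?J +> xs ! i)"
    using assms i unfolding regular_sequence_def by (simp add: Let_def)
  have "?J +> r \<in> carrier (R Quot ?J)"
    using r a_rcosetsI[OF ideal.Icarr[OF J, THEN subsetI]] by (simp add: FactRing_def)
  moreover have "(?J +> xs ! i) \<otimes>\<^bsub>R Quot ?J\<^esub> (?J +> r) = \<zero>\<^bsub>R Quot ?J\<^esub>"
    using ideal.rcoset_mult_add[OF J xi r] a_rcos_zero[OF J mem] by (simp add: FactRing_def)
  ultimately have "?J +> r = ?J"
    using nzd unfolding nonzerodivisor_def by (simp add: FactRing_def)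
  then show "r \<in> ?J"
    by (rule ideal.rcos_const_imp_mem[OF J r])
qed

text \<open>The \<open>q\<close>-th power of a form in \<open>xs\<close> is a form of the same
  degree in the \<open>q\<close>-th powers of \<open>xs\<close>.\<close>

lemma frobenius_power_ideal_pow_subset:
  assumes p: "Factorial_Ring.prime (p::nat)" and char: "[p] \<cdot> \<one> = \<zero>"
    and xs: "set xs \<subseteq> carrier R"
  shows "frobenius_power R (ideal_pow R (Idl (set xs)) m) (p ^ e)
    \<subseteq> ideal_pow R (Idl (set (map (\<lambda>x. x [^] (p ^ e)) xs))) m"
  unfolding frobenius_power_def
proof (rule genideal_minimal)
  let ?q = "p ^ e" and ?zs = "map (\<lambda>x. x [^] (p ^ e)) xs"
  have q: "?q > 0"
    using prime_gt_0_nat[OF p] by simp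
  have zs: "set ?zs \<subseteq> carrier R"
    using xs by auto
  then show "ideal (ideal_pow R (Idl (set ?zs)) m) R"
    by (intro ideal_pow_is_ideal genideal_ideal)
  show "(\<lambda>x. x [^] ?q) ` ideal_pow R (Idl (set xs)) m \<subseteq> ideal_pow R (Idl (set ?zs)) m"
  proof (rule image_subsetI)
    fix w assume "w \<in> ideal_pow R (Idl (set xs)) m"
    then obtain b where b: "w = form_eval R xs m b" "\<forall>\<alpha>. b \<alpha> \<in> carrier R"
      unfolding forms_eq_ideal_pow[OF xs, symmetric] forms_def by blast
    have "w [^] ?q = form_eval R ?zs m (\<lambda>\<alpha>. b \<alpha> [^] ?q)"
      unfolding b(1)
      by (rule form_eval_pow[OF xs b(2) q, symmetric]) (rule freshmans_dream_pow[OF p char])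
    moreover have "\<forall>\<alpha>. b \<alpha> [^] ?q \<in> carrier R"
      using b(2) by simp
    ultimately show "w [^] ?q \<in> ideal_pow R (Idl (set ?zs)) m"
      unfolding forms_eq_ideal_pow[OF zs, symmetric] forms_def by blast
  qed
qed

text \<open>The multiplier and threshold found for the value of the form work for all its
  coefficients at once.\<close>

lemma coefficients_mem_tight_closure:
  assumes p: "Factorial_Ring.prime p" and char: "[p] \<cdot> \<one> = \<zero>"
    and reg: "weakly_regular R {} (rev xs)" and xs: "set xs \<subseteq> carrier R"
    and a: "\<forall>\<alpha>. a \<alpha> \<in> carrier R"
    and mem: "form_eval R xs n a \<in> tight_closure R p (ideal_pow R (Idl (set xs)) (Suc n))"
  shows "\<forall>\<alpha>\<in>monomials xs n. a \<alpha> \<in> tight_closure R p (Idl (set xs))"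
proof
  fix \<alpha> assume \<alpha>: "\<alpha> \<in> monomials xs n"
  let ?I = "Idl (set xs)"
  obtain c e\<^sub>0 where c: "c \<in> ring_circ R" "c \<in> carrier R"
    and cu: "\<And>e. e \<ge> e\<^sub>0 \<Longrightarrow> c \<otimes> form_eval R xs n a [^] (p ^ e)
      \<in> frobenius_power R (ideal_pow R ?I (Suc n)) (p ^ e)"
    using mem by (rule tight_closureE) blast
  show "a \<alpha> \<in> tight_closure R p ?I"
  proof (rule tight_closureI)
    show "a \<alpha> \<in> carrier R" "c \<in> ring_circ R"
      using a c by simp_all
    fix e assume e: "e \<ge> e\<^sub>0"
    let ?q = "p ^ e" and ?zs = "map (\<lambda>x. x [^] (p ^ e)) xs"
    have q: "?q > 0"
      using prime_gt_0_nat[OF p] by simp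
    have zs: "set ?zs \<subseteq> carrier R"
      using xs by auto
    have "weakly_regular R {} (map (\<lambda>x. x [^] ?q) (rev xs))"
      using reg xs q by (intro weakly_regular_map_pow) auto
    then have "weakly_regular R {} (rev ?zs)"
      by (simp only: rev_map)
    then have qr: "quasi_regular R ?zs"
      using zs by (rule weakly_regular_imp_quasi_regular)
    have ca: "\<forall>\<alpha>. a \<alpha> [^] ?q \<in> carrier R" "\<forall>\<alpha>. c \<otimes> a \<alpha> [^] ?q \<in> carrier R"
      using a c by simp_all
    have "form_eval R ?zs n (\<lambda>\<alpha>. a \<alpha> [^] ?q) = form_eval R xs n a [^] ?q"
      by (rule form_eval_pow[OF xs a q]) (rule freshmans_dream_pow[OF p char])
    \<comment> \<open>Only \<open>c\<close> times the power of the value is known to lie in the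
      ideal, so \<open>c\<close> is absorbed into the coefficients before quasi-regularity is
      applied.\<close>
    then have "form_eval R ?zs n (\<lambda>\<alpha>. c \<otimes> a \<alpha> [^] ?q) = c \<otimes> form_eval R xs n a [^] ?q"
      unfolding form_eval_smult[OF zs ca(1) c(2)] by (rule arg_cong)
    then have "form_eval R ?zs n (\<lambda>\<alpha>. c \<otimes> a \<alpha> [^] ?q) \<in> ideal_pow R (Idl (set ?zs)) (Suc n)"
      using cu[OF e] frobenius_power_ideal_pow_subset[OF p char xs, of "Suc n" e] by auto
    then have "\<forall>\<alpha>\<in>monomials ?zs n. c \<otimes> a \<alpha> [^] ?q \<in> Idl (set ?zs)"
      by (rule quasi_regularD[OF qr ca(2)])
    \<comment> \<open>The set of paths depends only on the length of the list.\<close>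
    moreover have "monomials ?zs n = monomials xs n"
      by (induction xs n rule: monomials.induct) simp_all
    ultimately have "c \<otimes> a \<alpha> [^] ?q \<in> Idl (set ?zs)"
      using \<alpha> by blast
    moreover have "Idl (set ?zs) \<subseteq> frobenius_power R ?I ?q"
      unfolding frobenius_power_def
      using genideal_self[OF xs] ideal.Icarr[OF genideal_ideal[OF xs]]
      by (intro Idl_mono) auto
    ultimately show "c \<otimes> a \<alpha> [^] ?q \<in> frobenius_power R ?I ?q"
      by blast
  qed
qed

end

theorem proposition1p4:
  fixes R :: "('a, 'b) ring_scheme" and p n :: nat and xs :: "'a list" and I :: "'a set"
  assumes "cring R" and "noetherian_ring R"
    and "Factorial_Ring.prime p" and "ring_char R = p"
    and "regular_sequence R xs" and "I = Idl\<^bsub>R\<^esub> (set xs)"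
    and "n \<ge> 1"
  shows "ideal_pow R I n \<inter> tight_closure R p (ideal_pow R I (n + 1))
           = ideal_prod R (ideal_pow R I n) (tight_closure R p I)"
proof -
  interpret cring R by fact
  note p = assms(3)
  have char: "[p] \<cdot>\<^bsub>R\<^esub> \<one>\<^bsub>R\<^esub> = \<zero>\<^bsub>R\<^esub>"
    using add.pow_ord_eq_1[OF one_closed] assms(4) unfolding ring_char_def by simp
  \<comment> \<open>The reversed list generates the same ideal and puts the last element of the
    regular sequence at the head, as the quasi-regularity argument requires.\<close>
  have xs: "set (rev xs) \<subseteq> carrier R"
    using assms(5) unfolding regular_sequence_def by simp
  have I_eq: "I = Idl\<^bsub>R\<^esub> (set (rev xs))"
    using assms(6) by simp
  have I: "ideal I R"
    unfolding I_eq using xs by (rule genideal_ideal)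
  have P: "ideal (ideal_pow R I m) R" for m
    using I by (rule ideal_pow_is_ideal)
  have carr: "J \<subseteq> carrier R" if "ideal J R" for J
    using ideal.Icarr[OF that] by blast
  have T: "ideal (tight_closure R p I) R"
    using p char carr[OF I] by (rule tight_closure_ideal)
  have T': "ideal (tight_closure R p (ideal_pow R I (Suc n))) R"
    using p char carr[OF P] by (rule tight_closure_ideal)
  show ?thesis
  proof
    show "ideal_pow R I n \<inter> tight_closure R p (ideal_pow R I (n + 1))
        \<subseteq> ideal_prod R (ideal_pow R I n) (tight_closure R p I)"
    proof
      fix u assume "u \<in> ideal_pow R I n \<inter> tight_closure R p (ideal_pow R I (n + 1))"
      then have "u \<in> forms R (carrier R) (rev xs) n"
        and ut: "u \<in> tight_closure R p (ideal_pow R I (Suc n))"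
        unfolding forms_eq_ideal_pow[OF xs] I_eq by simp_all
      then obtain a where a: "u = form_eval R (rev xs) n a" "\<forall>\<alpha>. a \<alpha> \<in> carrier R"
        unfolding forms_def by blast
      have "weakly_regular R {} (rev (rev xs))"
        using regular_sequence_imp_weakly_regular[OF assms(5)] by simp
      then have "\<forall>\<alpha>\<in>monomials (rev xs) n. a \<alpha> \<in> tight_closure R p I"
        using ut unfolding a(1) I_eq
        by (intro coefficients_mem_tight_closure[OF p char _ xs a(2)])
      \<comment> \<open>A form of degree \<open>n\<close> whose coefficients at all monomials lie in
        the tight closure of \<open>I\<close> has its value in the product of that ideal with
        I^n.\<close>
      then have "u \<in> ideal_prod R (tight_closure R p I) (ideal_pow R I n)"
        unfolding a(1) I_eq by (intro form_eval_mem[OF T[unfolded I_eq] xs])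
      then show "u \<in> ideal_prod R (ideal_pow R I n) (tight_closure R p I)"
        unfolding ideal_prod_commute[OF P T] .
    qed
    show "ideal_prod R (ideal_pow R I n) (tight_closure R p I)
        \<subseteq> ideal_pow R I n \<inter> tight_closure R p (ideal_pow R I (n + 1))"
    proof (intro Int_greatest)
      show "ideal_prod R (ideal_pow R I n) (tight_closure R p I) \<subseteq> ideal_pow R I n"
        using ideal_prod_inter[OF P T] by blast
      show "ideal_prod R (ideal_pow R I n) (tight_closure R p I)
          \<subseteq> tight_closure R p (ideal_pow R I (n + 1))"
        \<comment> \<open>Applied to the ideals I^n and I, whose product is I^(n+1).\<close>
        using mult_tight_closure_mem[OF carr[OF P] carr[OF I]]
        unfolding Suc_eq_plus1[symmetric] ideal_pow_Suc
        by (intro ideal_prod_subset[OF T'[unfolded ideal_pow_Suc]]) blast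
    qed
  qed
qed

end
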